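(* Fix a prime $p$ and $d\geq 1$. Let $(\mathbf A_r)_{r\geq0}$ be a sequence of maps $\mathbb N^d\to\Omega\setminus\{0\}$ and $(\mathbf g_r)_{r\geq 0}$ a sequence of maps $\mathbb N^d\to\mathcal O\setminus\{0\}$. Assume there exists $\mathcal N\subset\bigcup_{t\geq1}(\{0,\dots,p^t-1\}^d\times\{t\})$ such that for all $r\geq 0$: (i) $|\mathbf A_r(\mathbf 0)|_p=1$; (ii) for all $\mathbf m\in\mathbb N^d$, $\mathbf A_r(\mathbf m)\in\mathbf g_r(\mathbf m)\mathcal O$; (iii) for all $s\in\mathbb N$ and $\mathbf m\in\mathbb N^d$: (a) for all $\mathbf u\in\Psi_s(\mathcal N)$ and $\mathbf v\in\{0,\dots,p-1\}^d$, $\frac{\mathbf A_r(\mathbf v+\mathbf up+\mathbf mp^{s+1})}{\mathbf A_r(\mathbf v+\mathbf up)}-\frac{\mathbf A_{r+1}(\mathbf u+\mathbf mp^s)}{\mathbf A_{r+1}(\mathbf u)}\in p^{s+1}\frac{\mathbf g_{r+s+1}(\mathbf m)}{\mathbf A_r(\mathbf v+\mathbf up)}\mathcal O$; (a1) moreover, if $\mathbf v+p\mathbf u\in\Psi_{s+1}(\mathcal N)$, then the same difference lies in $p^{s+1}\frac{\mathbf g_{r+s+1}(\mathbf m)}{\mathbf g_r(\mathbf v+\mathbf up)}\mathcal O$; (a2) if $\mathbf v+p\mathbf u\notin\Psi_{s+1}(\mathcal N)$, then $\frac{\mathbf A_{r+1}(\mathbf u+p^s\mathbf m)}{\mathbf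 A_{r+1}(\mathbf u)}\in p^{s+1}\frac{\mathbf g_{s+r+1}(\mathbf m)}{\mathbf g_r(\mathbf v+p\mathbf u)}\mathcal O$; (b) for all $(\mathbf n,t)\in\mathcal N$, $\mathbf g_r(\mathbf n+p^t\mathbf m)\in p^t\mathbf g_{r+t}(\mathbf m)\mathcal O$. Then, extending each $\mathbf A_r$ to $\mathbb Z^d$ by $\mathbf A_r(\mathbf n)=0$ whenever some coordinate of $\mathbf n$ is negative, for all $\mathbf a\in\{0,\dots,p-1\}^d$, $\mathbf m\in\mathbb N^d$, $s,r\in\mathbb N$ and $\mathbf K\in\mathbb Z^d$ we have $$\sum_{\mathbf mp^s\leq\mathbf j\leq(\mathbf m+\mathbf 1)p^s-\mathbf 1}\big(\mathbf A_r(\mathbf a+p(\mathbf K-\mathbf j))\mathbf A_{r+1}(\mathbf j)-\mathbf A_{r+1}(\mathbf K-\mathbf j)\mathbf A_r(\mathbf a+\mathbf jp)\big)\in p^{s+1}\mathbf g_{s+r+1}(\mathbf m)\mathcal O.$$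
   Context: $\Omega$ is the completion of an algebraic closure of $\mathbb Q_p$, $\mathcal O$ its ring of integers, $|\cdot|_p$ the $p$-adic absolute value. Vector inequalities are coordinatewise, $\mathbf 1=(1,\dots,1)$, and the sum runs over $\mathbf j\in\mathbb Z^d$. For $\mathcal N\subset\bigcup_{t\geq1}(\{0,\dots,p^t-1\}^d\times\{t\})$ and $s\in\mathbb N$, $\Psi_s(\mathcal N)$ is the set of $\mathbf u\in\{0,\dots,p^s-1\}^d$ such that for all $(\mathbf n,t)\in\mathcal N$ with $t\leq s$ and all $\mathbf j\in\{0,\dots,p^{s-t}-1\}^d$ we have $\mathbf u\neq\mathbf j+p^{s-t}\mathbf n$ (in particular $\Psi_0(\mathcal N)=\{\mathbf 0\}$). *)

theory Defs
  imports
    "HOL-Algebra.Algebraic_Closure_Type"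
    "HOL-Analysis.Analysis"
begin

definition padic_abs :: "nat \<Rightarrow> rat \<Rightarrow> real" where
  "padic_abs p q =
     (if q = 0 then 0
      else case quotient_of q of (a, b) \<Rightarrow>
        real p powi (int (multiplicity (int p) b) - int (multiplicity (int p) a)))"

locale ultrametric_absolute_value =
  fixes absv :: "'a::field \<Rightarrow> real"
  assumes absv_nonneg: "absv x \<ge> 0"
    and absv_eq_0_iff: "absv x = 0 \<longleftrightarrow> x = 0"
    and absv_mult: "absv (x * y) = absv x * absv y"
    and absv_add_le: "absv (x + y) \<le> max (absv x) (absv y)"

definition abs_dist :: "('a::field \<Rightarrow> real) \<Rightarrow> 'a \<Rightarrow> 'a \<Rightarrow> real" where
  "abs_dist absv x y = absv (x - y)"

lemma (in ultrametric_absolute_value) Metric_space_abs_dist: "Metric_space S (abs_dist absv)"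
proof -
  have "absv 1 * absv 1 = absv 1" "absv 1 \<noteq> 0"
    using absv_mult[of 1 1] absv_eq_0_iff[of 1] by auto
  then have "absv 1 = 1"
    by simp
  moreover have "absv (- 1) * absv (- 1) = absv 1"
    using absv_mult[of "- 1" "- 1"] by simp
  ultimately have "absv (- 1) = 1"
    using absv_nonneg[of "- 1"] by (simp add: square_eq_1_iff)
  then have minus: "absv (- x) = absv x" for x
    using absv_mult[of "- 1" x] by simp
  show ?thesis
  proof
    fix x y z
    show "0 \<le> abs_dist absv x y"
      by (simp add: abs_dist_def absv_nonneg)
    show "abs_dist absv x y = abs_dist absv y x"
      using minus[of "x - y"] by (simp add: abs_dist_def)
    show "abs_dist absv x y = 0 \<longleftrightarrow> x = y"
      by (simp add: abs_dist_def absv_eq_0_iff)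
    show "abs_dist absv x z \<le> abs_dist absv x y + abs_dist absv y z"
      using absv_add_le[of "x - y" "y - z"] absv_nonneg[of "x - y"] absv_nonneg[of "y - z"]
      by (simp add: abs_dist_def)
  qed
qed

definition is_completion :: "('a::field \<Rightarrow> real) \<Rightarrow> 'a set \<Rightarrow> 'a set \<Rightarrow> bool" where
  "is_completion absv E F \<longleftrightarrow>
     E \<subseteq> F \<and>
     Metric_space.mcomplete F (abs_dist absv) \<and>
     Metric_space.mtopology F (abs_dist absv) closure_of E = F"

text \<open>
  The field \<open>\<Omega>\<close> is the whole type \<open>'a\<close>, with \<open>absv\<close> its \<open>p\<close>-adic absolute value:
  it is the completion of a subfield \<open>L\<close> that is an algebraic closure of a subfield \<open>Qp\<close>,
  and \<open>Qp\<close> is the completion of \<open>\<rat>\<close> for the usual \<open>p\<close>-adic absolute value.  This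
  determines \<open>('a, absv)\<close> up to isometric isomorphism.  The locale
  \<open>algebraic_closure\<close> includes that \<open>L\<close> is a field and \<open>Qp\<close> a subfield of it.
\<close>
locale completed_algebraic_closure_of_Qp =
  ultrametric_absolute_value absv for p :: nat and absv :: "'a::field_char_0 \<Rightarrow> real" +
  assumes absv_of_rat: "absv (of_rat q) = padic_abs p q"
    and completed_closure:
      "\<exists>Qp L. is_completion absv \<rat> Qp
            \<and> algebraic_closure (ring_of_type_algebra \<lparr> carrier := L \<rparr>) Qp
            \<and> is_completion absv L UNIV"

definition integer_ring :: "('a::field \<Rightarrow> real) \<Rightarrow> 'a set" where
  "integer_ring absv = {x. absv x \<le> 1}"

definition digit_box :: "nat \<Rightarrow> (nat ^ 'd) set" where
  "digit_box q = {n. \<forall>i. n $ i < q}"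

definition Psi :: "nat \<Rightarrow> ((nat ^ 'd) \<times> nat) set \<Rightarrow> nat \<Rightarrow> (nat ^ 'd) set" where
  "Psi p N s =
     {u \<in> digit_box (p ^ s). \<forall>(n, t) \<in> N. t \<le> s \<longrightarrow>
        (\<forall>j \<in> digit_box (p ^ (s - t)). u \<noteq> j + p ^ (s - t) *s n)}"

definition int_vec :: "nat ^ 'd \<Rightarrow> int ^ 'd" where
  "int_vec n = (\<chi> i. int (n $ i))"

definition zero_ext :: "(nat ^ 'd \<Rightarrow> 'a::zero) \<Rightarrow> int ^ 'd \<Rightarrow> 'a" where
  "zero_ext A n = (if \<exists>i. n $ i < 0 then 0 else A (\<chi> i. nat (n $ i)))"

end

theory Submission
  imports Defs
begin

text \<open>
  Dwork's argument.  Write \<open>S(K, s, m)\<close> for the sum in question and induct on \<open>s\<close>.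
  For \<open>t \<le> s\<close> one shows, modulo \<open>p\<^sup>s\<^sup>+\<^sup>1 g\<^bsub>s+r+1\<^esub>(m)\<close>,
  \<open>S(K + p\<^sup>s m, s, m) \<equiv> \<Sum>\<^bsub>j \<in> \<Psi>\<^bsub>s-t\<^esub>\<^esub> A\<^bsub>t+r+1\<^esub>(j + p\<^sup>s\<^sup>-\<^sup>t m) / A\<^bsub>t+r+1\<^esub>(j) \<sdot> S(K, t, j)\<close>:
  for \<open>t = 0\<close> this is (a), the indices outside \<open>\<Psi>\<^sub>s\<close> being grouped into blocks to which the
  induction hypothesis and (b) apply; the step from \<open>t\<close> to \<open>t + 1\<close> splits off the last digit of \<open>j\<close>
  and uses (a1), (a2) and the hypothesis for \<open>t < s\<close>.  At \<open>t = s\<close> everything reduces to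
  \<open>S(K, s, 0)\<close>.  Since the sum of \<open>S(K, s, m)\<close> over all \<open>m\<close> vanishes by the reflection
  \<open>j \<mapsto> K - j\<close>, an induction on \<open>K\<close> shows that \<open>S(K, s, 0)\<close> is divisible by \<open>p\<^sup>s\<^sup>+\<^sup>1\<close>.
\<close>

section \<open>Digit boxes and division with remainder\<close>

no_notation fps_nth (infixl \<open>$\<close> 75)

lemma Suc_0_smult: "Suc 0 *s v = v"
  by (simp add: vec_eq_iff)

lemma digit_box_iff: "u \<in> digit_box q \<longleftrightarrow> (\<forall>i. u $ i < q)"
  by (simp add: digit_box_def)

lemma digit_box_1: "digit_box (Suc 0) = {0}"
  by (auto simp: digit_box_def vec_eq_iff)

lemma finite_digit_box: "finite (digit_box q :: (nat ^ 'd::finite) set)"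
proof (rule finite_imageD)
  show "finite (vec_nth ` (digit_box q :: (nat ^ 'd) set))"
    by (rule finite_subset[OF _ finite_PiE[of UNIV "\<lambda>_. {..<q}"]])
      (auto simp: digit_box_def)
  show "inj_on vec_nth (digit_box q :: (nat ^ 'd) set)"
    by (auto simp: inj_on_def vec_eq_iff)
qed

text \<open>Coordinatewise division with remainder by \<open>b\<close>: \<open>v\<close> collects
  the remainders and \<open>u\<close> the quotients, and a number is below \<open>b * c\<close>
  exactly when its quotient is below \<open>c\<close>.\<close>

lemma digit_box_mult_reindex:
  assumes "b > 0"
  shows "inj_on (\<lambda>(v, u). v + b *s u) (digit_box b \<times> (UNIV :: (nat ^ 'd) set))"
    and "(\<lambda>(v, u). v + b *s u) ` (digit_box b \<times> digit_box c) = (digit_box (b * c) :: (nat ^ 'd) set)"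
proof -
  have dm: "x = x' \<and> y = y'" if "x + b * y = x' + b * y'" "x < b" "x' < b" for x y x' y' :: nat
    using arg_cong[OF that(1), of "\<lambda>z. z mod b"] arg_cong[OF that(1), of "\<lambda>z. z div b"] that(2,3) assms
    by simp
  show "inj_on (\<lambda>(v, u). v + b *s u) (digit_box b \<times> (UNIV :: (nat ^ 'd) set))"
    unfolding inj_on_def by (clarsimp simp: vec_eq_iff digit_box_iff) (use dm in blast)
  show "(\<lambda>(v, u). v + b *s u) ` (digit_box b \<times> digit_box c) = (digit_box (b * c) :: (nat ^ 'd) set)"
  proof (intro equalityI subsetI)
    fix x :: "nat ^ 'd"
    assume "x \<in> (\<lambda>(v, u). v + b *s u) ` (digit_box b \<times> digit_box c)"
    then obtain v u where x: "x = v + b *s u" and vu: "\<And>i. v $ i < b" "\<And>i. u $ i < c"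
      by (auto simp: digit_box_iff)
    have "v $ i + b * u $ i < b * c" for i
    proof -
      have "v $ i + b * u $ i < b * Suc (u $ i)"
        using vu(1)[of i] by simp
      also have "\<dots> \<le> b * c"
        using vu(2)[of i] by (intro mult_le_mono2) simp
      finally show ?thesis .
    qed
    then show "x \<in> digit_box (b * c)"
      by (simp add: x digit_box_iff)
  next
    fix x :: "nat ^ 'd"
    assume "x \<in> digit_box (b * c)"
    then have "(\<chi> i. x $ i mod b) \<in> digit_box b" "(\<chi> i. x $ i div b) \<in> digit_box c"
      using assms by (auto simp: digit_box_iff less_mult_imp_div_less mult.commute)
    moreover have "x = (\<chi> i. x $ i mod b) + b *s (\<chi> i. x $ i div b)"
      by (simp add: vec_eq_iff)
    ultimately show "x \<in> (\<lambda>(v, u). v + b *s u) ` (digit_box b \<times> digit_box c)"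
      by force
  qed
qed

text \<open>Used in two ways: with \<open>b = p\<close> it splits off the lowest digit, with
  \<open>b\<close> a power of \<open>p\<close> it cuts the box into consecutive blocks of side
  \<open>b\<close>.\<close>

lemma sum_digit_box_mult:
  fixes f :: "nat ^ 'd::finite \<Rightarrow> 'b::comm_monoid_add"
  assumes "b > 0"
  shows "(\<Sum>x\<in>digit_box (b * c). f x) = (\<Sum>u\<in>digit_box c. \<Sum>v\<in>digit_box b. f (v + b *s u))"
proof -
  have "(\<Sum>x\<in>digit_box (b * c). f x) = (\<Sum>z\<in>digit_box b \<times> digit_box c. f (fst z + b *s snd z))"
    unfolding digit_box_mult_reindex(2)[OF assms, symmetric]
    by (subst sum.reindex)
      (auto intro: inj_on_subset[OF digit_box_mult_reindex(1)[OF assms]] simp: case_prod_beta)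
  also have "\<dots> = (\<Sum>u\<in>digit_box c. \<Sum>v\<in>digit_box b. f (v + b *s u))"
    by (subst sum.swap) (simp add: sum.cartesian_product case_prod_beta)
  finally show ?thesis .
qed

section \<open>The sets \<open>Psi\<close> in terms of leading digits\<close>

text \<open>The block of all \<open>j + q *s n\<close>, with \<open>j\<close> in the box of side
  \<open>q\<close>, is the fibre over \<open>n\<close> of coordinatewise division by
  \<open>q\<close>. So a pair \<open>(n, t)\<close> excludes one value of the leading
  \<open>t\<close> digits of \<open>u\<close>.\<close>

lemma Psi_iff:
  fixes u :: "nat ^ 'd"
  assumes "p > 0"
  shows "u \<in> Psi p N s \<longleftrightarrow> u \<in> digit_box (p ^ s) \<and>
    (\<forall>(n, t)\<in>N. t \<le> s \<longrightarrow> (\<chi> i. u $ i div p ^ (s - t)) \<noteq> n)"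
proof -
  have "(\<exists>j\<in>digit_box q. u = j + q *s n) \<longleftrightarrow> (\<chi> i. u $ i div q) = n" if "q > 0" for q and n :: "nat ^ 'd"
  proof
    assume "(\<chi> i. u $ i div q) = n"
    moreover have "(\<chi> i. u $ i mod q) \<in> digit_box q"
      using that by (simp add: digit_box_iff)
    moreover have "u = (\<chi> i. u $ i mod q) + q *s (\<chi> i. u $ i div q)"
      by (simp add: vec_eq_iff)
    ultimately show "\<exists>j\<in>digit_box q. u = j + q *s n"
      by blast
  qed (use that in \<open>auto simp: digit_box_iff vec_eq_iff\<close>)
  from this have "(\<forall>j\<in>digit_box (p ^ (s - t)). u \<noteq> j + p ^ (s - t) *s n)
      \<longleftrightarrow> (\<chi> i. u $ i div p ^ (s - t)) \<noteq> n" for t n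
    using assms by (metis zero_less_power)
  then show ?thesis
    unfolding Psi_def by auto
qed

text \<open>A new lowest digit leaves the quotients for \<open>t \<le> s\<close> unchanged, so those
  constraints are the ones on \<open>u\<close>. The only new one, \<open>t = Suc s\<close>, divides
  by \<open>p ^ 0\<close> and forbids the vector itself.\<close>

lemma Psi_Suc_iff:
  assumes "p > 0" "v \<in> digit_box p" "\<And>n t. (n, t) \<in> N \<Longrightarrow> t > 0"
  shows "v + p *s u \<in> Psi p N (Suc s) \<longleftrightarrow> u \<in> Psi p N s \<and> (v + p *s u, Suc s) \<notin> N"
proof -
  have v: "v $ i < p" for i
    using assms(2) by (simp add: digit_box_iff)
  have "v $ i + p * u $ i < p * p ^ s \<longleftrightarrow> u $ i < p ^ s" for i
    using div_less_iff_less_mult[of p "v $ i + p * u $ i" "p ^ s"] v[of i] assms(1)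
    by (simp add: mult.commute)
  then have box: "v + p *s u \<in> digit_box (p ^ Suc s) \<longleftrightarrow> u \<in> digit_box (p ^ s)"
    by (simp add: digit_box_iff)
  have "(v $ i + p * u $ i) div p ^ (Suc s - t) = u $ i div p ^ (s - t)" if "t \<le> s" for i t
    using that v[of i] assms(1) by (simp add: Suc_diff_le div_mult2_eq)
  then have dv: "(\<chi> i. (v + p *s u) $ i div p ^ (Suc s - t)) = (\<chi> i. u $ i div p ^ (s - t))" if "t \<le> s" for t
    using that by simp
  have "(\<chi> i. (v + p *s u) $ i div p ^ (Suc s - Suc s)) = v + p *s u"
    by (simp add: vec_eq_iff)
  then show ?thesis
    unfolding Psi_iff[OF assms(1)] box using dv by (auto simp: le_Suc_eq simp del: vector_add_component)
qed

lemma Psi_0: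
  assumes "\<And>n t. (n, t) \<in> N \<Longrightarrow> t > 0"
  shows "Psi p N 0 = {0}"
  using assms by (auto simp: Psi_def digit_box_1)

lemma Psi_subset: "Psi p N s \<subseteq> digit_box (p ^ s)"
  by (auto simp: Psi_def)

section \<open>Integer vectors and zero extension\<close>

lemma zero_ext_int_vec: "zero_ext A (int_vec n) = A n"
  by (simp add: zero_ext_def int_vec_def)

lemma int_vec_add: "int_vec (m + n) = int_vec m + int_vec n"
  by (simp add: int_vec_def vec_eq_iff)

lemma int_vec_smult: "int_vec (k *s n) = int k *s int_vec n"
  by (simp add: int_vec_def vec_eq_iff)

lemma int_vec_nth: "int_vec n $ i = int (n $ i)"
  by (simp add: int_vec_def)

lemma nonneg_int_vecE:
  fixes K :: "int ^ 'd"
  assumes "\<And>i. K $ i \<ge> 0"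
  obtains k where "K = int_vec k"
proof
  show "K = int_vec (\<chi> i. nat (K $ i))"
    using assms by (simp add: vec_eq_iff int_vec_def)
qed

text \<open>The order on vectors is coordinatewise, so the interval over which the theorem sums is a
  translated digit box.\<close>

lemma int_vec_block:
  fixes m :: "nat ^ 'd::finite"
  shows "{int q *s int_vec m .. int q *s (int_vec m + 1) - 1} = (\<lambda>u. int_vec (u + q *s m)) ` digit_box q"
    (is "?I = ?B")
proof (intro equalityI subsetI)
  fix x
  assume "x \<in> ?I"
  then have *: "int q * int (m $ i) \<le> x $ i" "x $ i < int q * int (m $ i) + int q" for i
    unfolding atLeastAtMost_iff less_eq_vec_def by (auto simp: int_vec_nth algebra_simps dest!: spec[of _ i])
  then have "(\<chi> i. nat (x $ i - int q * int (m $ i))) \<in> digit_box q"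
    by (simp add: digit_box_iff nat_less_iff algebra_simps)
  moreover have "x = int_vec ((\<chi> i. nat (x $ i - int q * int (m $ i))) + q *s m)"
    using * by (simp add: vec_eq_iff int_vec_nth)
  ultimately show "x \<in> ?B"
    by blast
next
  fix x
  assume "x \<in> ?B"
  then obtain u where x: "x = int_vec (u + q *s m)" and u: "\<And>i. u $ i < q"
    by (auto simp: digit_box_iff)
  have "int (u $ i) + 1 \<le> int q" for i
    using u[of i] by simp
  then show "x \<in> ?I"
    by (simp add: x less_eq_vec_def int_vec_nth algebra_simps)
qed

lemma inj_int_vec_add: "inj_on (\<lambda>u. int_vec (u + n)) S"
  by (simp add: inj_on_def vec_eq_iff int_vec_nth)

section \<open>Ultrametric estimates\<close>

context ultrametric_absolute_value
begin

lemma absv_0: "absv 0 = 0"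
  by (simp add: absv_eq_0_iff)

lemma absv_1: "absv 1 = 1"
  using absv_mult[of 1 1] absv_eq_0_iff[of 1] by auto

lemma absv_minus: "absv (- x) = absv x"
proof -
  have "absv (- 1) * absv (- 1) = 1"
    using absv_mult[of "- 1" "- 1"] by (simp add: absv_1)
  then have "absv (- 1) = 1"
    using absv_nonneg[of "- 1"] by (simp add: square_eq_1_iff)
  then show ?thesis
    using absv_mult[of "- 1" x] by simp
qed

lemma absv_divide: "absv (x / y) = absv x / absv y"
proof (cases "y = 0")
  case False
  then show ?thesis
    using absv_mult[of "x / y" y] absv_eq_0_iff[of y] by (simp add: field_simps)
qed (simp add: absv_0)

lemma absv_power: "absv (x ^ n) = absv x ^ n"
  by (induction n) (simp_all add: absv_1 absv_mult)

lemma absv_add_bound: "absv x \<le> c \<Longrightarrow> absv y \<le> c \<Longrightarrow> absv (x + y) \<le> c"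
  using absv_add_le[of x y] by simp

lemma absv_sum_bound:
  assumes "c \<ge> 0" "\<And>x. x \<in> S \<Longrightarrow> absv (f x) \<le> c"
  shows "absv (sum f S) \<le> c"
  using assms(2)
  by (induction S rule: infinite_finite_induct) (auto simp: absv_0 assms(1) intro: absv_add_bound)

text \<open>Turns each membership in a multiple of the integer ring into an inequality; for
  \<open>c = 0\<close> both sides say \<open>x = 0\<close>.\<close>

lemma mem_mult_integer_ring_iff: "x \<in> (*) c ` integer_ring absv \<longleftrightarrow> absv x \<le> absv c"
proof (cases "c = 0")
  case True
  then show ?thesis
    using absv_nonneg[of x] by (auto simp: integer_ring_def absv_0 absv_eq_0_iff image_iff intro!: exI[of _ 0])
next
  case False
  then have c: "absv c > 0"
    using absv_nonneg[of c] absv_eq_0_iff[of c] by linarith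
  show ?thesis
  proof
    assume "x \<in> (*) c ` integer_ring absv"
    then show "absv x \<le> absv c"
      using c by (auto simp: integer_ring_def absv_mult)
  next
    assume "absv x \<le> absv c"
    then have "x / c \<in> integer_ring absv"
      using c by (simp add: integer_ring_def absv_divide)
    then show "x \<in> (*) c ` integer_ring absv"
      using False by (intro image_eqI[of _ _ "x / c"]) auto
  qed
qed

text \<open>
  The complement of \<^term>\<open>Psi p N s\<close> in the box is a union of blocks
  \<open>{j + p ^ (s - t) *s n | j}\<close> with \<open>(n, t) \<in> N\<close>, and such blocks are nested or disjoint,
  so a bound on block sums passes to the sum over the complement.
\<close>

lemma absv_sum_compl_Psi_bound:
  fixes f :: "nat ^ 'd::finite \<Rightarrow> 'a"
  assumes p: "p > 0" and N: "\<And>n t. (n, t) \<in> N \<Longrightarrow> t > 0" and c: "c \<ge> 0"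
    and blocks: "\<And>n t. (n, t) \<in> N \<Longrightarrow> t \<le> s \<Longrightarrow>
      absv (\<Sum>j\<in>digit_box (p ^ (s - t)). f (j + p ^ (s - t) *s n)) \<le> c"
  shows "absv (\<Sum>u\<in>digit_box (p ^ s) - Psi p N s. f u) \<le> c"
  using blocks
proof (induction s arbitrary: f)
  case 0
  then show ?case
    by (simp add: Psi_0[OF N] digit_box_1 absv_0 c)
next
  case (Suc s)
  \<comment> \<open>\<open>F\<close> sums out the lowest digit: block sums of \<open>f\<close> at
    level \<open>Suc s\<close> with \<open>t \<le> s\<close> are block sums of \<open>F\<close> at
    level \<open>s\<close> for the same pair \<open>(n, t)\<close>.\<close>
  define F where "F u = (\<Sum>v\<in>digit_box p. f (v + p *s u))" for u
  define h where "h x = (if x \<in> Psi p N (Suc s) then 0 else f x)" for x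
  have Fb: "absv (\<Sum>j\<in>digit_box (p ^ (s - t)). F (j + p ^ (s - t) *s n)) \<le> c"
    if "(n, t) \<in> N" "t \<le> s" for n t
  proof -
    have "(\<Sum>j\<in>digit_box (p ^ (s - t)). F (j + p ^ (s - t) *s n))
        = (\<Sum>j\<in>digit_box (p * p ^ (s - t)). f (j + (p * p ^ (s - t)) *s n))"
      unfolding sum_digit_box_mult[OF p] F_def
      by (simp add: vector_add_ldistrib vector_smult_assoc add.assoc)
    also have "p * p ^ (s - t) = p ^ (Suc s - t)"
      using that(2) by (simp add: Suc_diff_le)
    finally show ?thesis
      using Suc.prems[of n t] that by simp
  qed
  \<comment> \<open>If \<open>u\<close> is in \<open>Psi p N s\<close>, then
    \<open>v + p *s u\<close> can leave \<open>Psi\<close> only as a one-point block at level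
    \<open>Suc s\<close>, which the hypothesis bounds. Otherwise all \<open>v + p *s u\<close> lie
    outside and the difference is 0.\<close>
  have hu: "absv ((\<Sum>v\<in>digit_box p. h (v + p *s u)) - (if u \<in> Psi p N s then 0 else F u)) \<le> c" for u
  proof (cases "u \<in> Psi p N s")
    case True
    have "absv (h (v + p *s u)) \<le> c" if v: "v \<in> digit_box p" for v
    proof (cases "(v + p *s u, Suc s) \<in> N")
      case in_N: True
      then show ?thesis
        using Suc.prems[OF in_N] c by (simp add: digit_box_1 h_def absv_0 Suc_0_smult)
    next
      case False
      then show ?thesis
        using True Psi_Suc_iff[OF p v N] c by (simp add: h_def absv_0)
    qed
    then show ?thesis
      using True by (simp add: absv_sum_bound c)
  next
    case False
    then show ?thesis
      using Psi_Suc_iff[where N = N, OF p _ N] c by (simp add: h_def absv_0 F_def)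
  qed
  have "(\<Sum>u\<in>digit_box (p ^ Suc s) - Psi p N (Suc s). f u) = (\<Sum>u\<in>digit_box (p ^ Suc s). h u)"
    by (rule sum.mono_neutral_cong_left) (auto simp: finite_digit_box h_def)
  also have "\<dots> = (\<Sum>u\<in>digit_box (p ^ s). \<Sum>v\<in>digit_box p. h (v + p *s u))"
    by (simp add: sum_digit_box_mult[OF p])
  also have "\<dots> = (\<Sum>u\<in>digit_box (p ^ s).
      (\<Sum>v\<in>digit_box p. h (v + p *s u)) - (if u \<in> Psi p N s then 0 else F u))
      + (\<Sum>u\<in>digit_box (p ^ s). if u \<in> Psi p N s then 0 else F u)"
    by (simp add: sum_subtractf)
  also have "(\<Sum>u\<in>digit_box (p ^ s). if u \<in> Psi p N s then 0 else F u)
      = (\<Sum>u\<in>digit_box (p ^ s) - Psi p N s. F u)"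
    by (rule sum.mono_neutral_cong_right) (auto simp: finite_digit_box)
  finally show ?case
    using Suc.IH[of F, OF Fb] hu by (auto intro!: absv_add_bound absv_sum_bound c)
qed

end

section \<open>Dwork's hypotheses and the block sums\<close>

text \<open>The hypotheses (i) to (iii) as inequalities between absolute values.\<close>

locale dwork_congruence = ultrametric_absolute_value absv for absv :: "'a::field \<Rightarrow> real" +
  fixes p :: nat
    and A g :: "nat \<Rightarrow> nat ^ 'd::finite \<Rightarrow> 'a"
    and N :: "((nat ^ 'd) \<times> nat) set"
  assumes p_pos: "p > 0"
    and A_nz: "A r m \<noteq> 0"
    and g_nz: "g r m \<noteq> 0"
    and g_le_1: "absv (g r m) \<le> 1"
    and N_pos: "(n, t) \<in> N \<Longrightarrow> t > 0"
    and A_0: "absv (A r 0) = 1"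
    and A_le_g: "absv (A r m) \<le> absv (g r m)"
    and cond_a: "u \<in> Psi p N s \<Longrightarrow> v \<in> digit_box p \<Longrightarrow>
        absv (A r (v + p *s u + p ^ (s + 1) *s m) / A r (v + p *s u)
          - A (r + 1) (u + p ^ s *s m) / A (r + 1) u)
        \<le> absv (of_nat p) ^ (s + 1) * (absv (g (r + s + 1) m) / absv (A r (v + p *s u)))"
    and cond_a1: "u \<in> Psi p N s \<Longrightarrow> v \<in> digit_box p \<Longrightarrow> v + p *s u \<in> Psi p N (s + 1) \<Longrightarrow>
        absv (A r (v + p *s u + p ^ (s + 1) *s m) / A r (v + p *s u)
          - A (r + 1) (u + p ^ s *s m) / A (r + 1) u)
        \<le> absv (of_nat p) ^ (s + 1) * (absv (g (r + s + 1) m) / absv (g r (v + p *s u)))"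
    and cond_a2: "u \<in> Psi p N s \<Longrightarrow> v \<in> digit_box p \<Longrightarrow> v + p *s u \<notin> Psi p N (s + 1) \<Longrightarrow>
        absv (A (r + 1) (u + p ^ s *s m) / A (r + 1) u)
        \<le> absv (of_nat p) ^ (s + 1) * (absv (g (s + r + 1) m) / absv (g r (v + p *s u)))"
    and cond_b: "(n, t) \<in> N \<Longrightarrow>
        absv (g r (n + p ^ t *s m)) \<le> absv (of_nat p) ^ t * absv (g (r + t) m)"
begin

abbreviation "\<pi> \<equiv> absv (of_nat p)"

text \<open>The summand of the theorem at \<open>int_vec j\<close>. As \<open>j\<close> and
  \<open>a + p *s j\<close> are nonnegative, only the factors containing \<open>K - j\<close> still
  need the zero extension.\<close>

definition cross_term :: "nat \<Rightarrow> nat ^ 'd \<Rightarrow> int ^ 'd \<Rightarrow> nat ^ 'd \<Rightarrow> 'a" where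
  "cross_term r a K j =
     zero_ext (A r) (int_vec a + int p *s (K - int_vec j)) * A (r + 1) j
     - zero_ext (A (r + 1)) (K - int_vec j) * A r (a + p *s j)"

text \<open>This is \<open>S(K, s, m)\<close> in the notation of the overview.\<close>

definition block_sum :: "nat \<Rightarrow> nat ^ 'd \<Rightarrow> int ^ 'd \<Rightarrow> nat \<Rightarrow> nat ^ 'd \<Rightarrow> 'a" where
  "block_sum r a K s m = (\<Sum>u\<in>digit_box (p ^ s). cross_term r a K (u + p ^ s *s m))"

lemma pow_p_pos: "p ^ s > 0"
  using p_pos by simp

lemma pi_nonneg: "\<pi> ^ s \<ge> 0"
  by (simp add: absv_nonneg)

lemma g_pos: "absv (g r m) > 0"
  using absv_nonneg[of "g r m"] g_nz[of r m] absv_eq_0_iff[of "g r m"] by linarith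

lemma A_pos: "absv (A r m) > 0"
  using absv_nonneg[of "A r m"] A_nz[of r m] absv_eq_0_iff[of "A r m"] by linarith

lemma modulus_nonneg: "\<pi> ^ s * absv (g r m) \<ge> 0"
  by (simp add: absv_nonneg)

lemma zero_ext_A_le_1: "absv (zero_ext (A r) K) \<le> 1"
  unfolding zero_ext_def using order_trans[OF A_le_g g_le_1] by (simp add: absv_0)

lemma block_sum_0: "block_sum r a K 0 m = cross_term r a K m"
  by (simp add: block_sum_def digit_box_1 Suc_0_smult)

lemma block_sum_Suc:
  "block_sum r a K (Suc t) u = (\<Sum>v\<in>digit_box p. block_sum r a K t (v + p *s u))"
proof -
  \<comment> \<open>With \<open>p ^ t\<close> as the first factor, the inner sum runs over the low
    \<open>t\<close> digits and \<open>v\<close> becomes the top digit, numbering the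
    sub-blocks.\<close>
  have "block_sum r a K (Suc t) u = (\<Sum>x\<in>digit_box (p ^ t * p). cross_term r a K (x + p ^ Suc t *s u))"
    by (simp add: block_sum_def mult.commute)
  also have "\<dots> = (\<Sum>v\<in>digit_box p. block_sum r a K t (v + p *s u))"
    unfolding sum_digit_box_mult[OF pow_p_pos] block_sum_def
    by (simp add: vector_add_ldistrib vector_smult_assoc add.assoc mult.commute)
  finally show ?thesis .
qed

section \<open>Vanishing of cross terms and of their total sum\<close>

text \<open>As \<open>a $ i < p\<close>, coordinate \<open>i\<close> of \<open>a + p (K - j)\<close>
  is at most \<open>a $ i - p < 0\<close>, so both products contain a vanishing zero
  extension.\<close>

lemma cross_term_eq_0:
  fixes K :: "int ^ 'd" and j :: "nat ^ 'd"
  assumes "a \<in> digit_box p" "K $ i < int (j $ i)"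
  shows "cross_term r a K j = 0"
proof -
  have "int (a $ i) + int p * (K $ i - int (j $ i)) < 0"
  proof -
    have "int p * (K $ i - int (j $ i)) \<le> int p * (- 1)"
      using assms(2) by (intro mult_left_mono) auto
    moreover have "a $ i < p"
      using assms(1) by (simp add: digit_box_iff)
    ultimately show ?thesis
      by simp
  qed
  then have "\<exists>i. (int_vec a + int p *s (K - int_vec j)) $ i < 0"
    by (intro exI[of _ i]) (simp add: int_vec_nth right_diff_distrib)
  moreover have "\<exists>i. (K - int_vec j) $ i < 0"
    using assms(2) by (intro exI[of _ i]) (simp add: int_vec_nth)
  ultimately show ?thesis
    by (simp only: cross_term_def zero_ext_def if_True) simp
qed

lemma block_sum_eq_0:
  fixes K :: "int ^ 'd"
  assumes "a \<in> digit_box p" "K $ i < 0"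
  shows "block_sum r a K s m = 0"
  unfolding block_sum_def using assms
  by (intro sum.neutral ballI cross_term_eq_0[of a K i]) (auto intro: less_le_trans)

text \<open>The reflection \<open>j \<mapsto> k - j\<close> exchanges the two products in the cross term.\<close>

lemma sum_cross_term_eq_0:
  fixes k :: "nat ^ 'd"
  assumes a: "a \<in> digit_box p" and M: "\<And>i. k $ i < M"
  shows "(\<Sum>j\<in>digit_box M. cross_term r a (int_vec k) j) = 0"
proof -
  define J where "J = {j :: nat ^ 'd. \<forall>i. j $ i \<le> k $ i}"
  \<comment> \<open>On \<open>J\<close> the truncated subtraction is exact, so there
    \<open>\<rho>\<close> is an involution.\<close>
  define \<rho> where "\<rho> j = (\<chi> i. k $ i - j $ i)" for j :: "nat ^ 'd"
  have JM: "J \<subseteq> digit_box M"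
    using M le_less_trans by (fastforce simp: J_def digit_box_iff)
  have "(\<Sum>j\<in>digit_box M. cross_term r a (int_vec k) j) = (\<Sum>j\<in>J. cross_term r a (int_vec k) j)"
  proof (rule sum.mono_neutral_right[OF finite_digit_box JM], safe)
    fix j
    assume "j \<notin> J"
    then obtain i where "k $ i < j $ i"
      by (auto simp: J_def not_le)
    then show "cross_term r a (int_vec k) j = 0"
      by (intro cross_term_eq_0[OF a, of _ i]) (simp add: int_vec_nth)
  qed
  also have "\<dots> = (\<Sum>j\<in>J. A r (a + p *s \<rho> j) * A (r + 1) j - A (r + 1) (\<rho> j) * A r (a + p *s j))"
  proof (rule sum.cong[OF refl])
    fix j
    assume "j \<in> J"
    then have "int_vec k - int_vec j = int_vec (\<rho> j)"
      by (simp add: J_def \<rho>_def vec_eq_iff int_vec_nth)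
    then show "cross_term r a (int_vec k) j
        = A r (a + p *s \<rho> j) * A (r + 1) j - A (r + 1) (\<rho> j) * A r (a + p *s j)"
      by (simp add: cross_term_def flip: int_vec_smult int_vec_add) (simp add: zero_ext_int_vec)
  qed
  also have "\<dots> = (\<Sum>j\<in>J. A r (a + p *s \<rho> j) * A (r + 1) j) - (\<Sum>j\<in>J. A (r + 1) (\<rho> j) * A r (a + p *s j))"
    by (rule sum_subtractf)
  also have "(\<Sum>j\<in>J. A r (a + p *s \<rho> j) * A (r + 1) j) = (\<Sum>j\<in>J. A (r + 1) (\<rho> j) * A r (a + p *s j))"
    by (rule sum.reindex_bij_witness[of _ \<rho> \<rho>]) (auto simp: J_def \<rho>_def vec_eq_iff mult.commute)
  finally show ?thesis
    by simp
qed

text \<open>The blocks with \<open>m\<close> in \<open>digit_box M\<close> tile the box of side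
  \<open>p ^ s * M\<close>, which contains every \<open>j \<le> k\<close>.\<close>

lemma sum_block_sum_eq_0:
  fixes k :: "nat ^ 'd"
  assumes "a \<in> digit_box p" and "\<And>i. k $ i < M"
  shows "(\<Sum>m\<in>digit_box M. block_sum r a (int_vec k) s m) = 0"
proof -
  have "k $ i < p ^ s * M" for i
    by (rule less_le_trans[OF assms(2)]) (use pow_p_pos[of s] in \<open>simp add: Suc_le_eq\<close>)
  then show ?thesis
    using sum_cross_term_eq_0[OF assms(1), of k "p ^ s * M" r]
    unfolding sum_digit_box_mult[OF pow_p_pos] block_sum_def by simp
qed

section \<open>Expansion of a block sum over \<open>Psi\<close>\<close>

lemma block_sum_expansion_0:
  assumes a: "a \<in> digit_box p"
    and IH: "\<And>t K n. t < s \<Longrightarrow> absv (block_sum r a K t n) \<le> \<pi> ^ (t + 1) * absv (g (t + r + 1) n)"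
  shows "absv (block_sum r a (K + int_vec (p ^ s *s m)) s m
      - (\<Sum>j\<in>Psi p N s. A (r + 1) (j + p ^ s *s m) / A (r + 1) j * cross_term r a K j))
      \<le> \<pi> ^ (s + 1) * absv (g (s + r + 1) m)" (is "_ \<le> ?c")
proof -
  define f where "f j = cross_term r a (K + int_vec (p ^ s *s m)) (j + p ^ s *s m)" for j
  define w where "w j = A (r + 1) (j + p ^ s *s m) / A (r + 1) j * cross_term r a K j" for j
  have c: "?c \<ge> 0"
    by (rule modulus_nonneg)
  \<comment> \<open>An excluded block is itself a block sum at level \<open>s - t\<close>, below
    \<open>s\<close> since \<open>t > 0\<close>. The induction hypothesis gives
    \<open>\<pi> ^ (s - t + 1)\<close> and (b) supplies the missing
    \<open>\<pi> ^ t\<close>.\<close>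
  have compl: "absv (\<Sum>u\<in>digit_box (p ^ s) - Psi p N s. f u) \<le> ?c"
  proof (rule absv_sum_compl_Psi_bound[OF p_pos N_pos c])
    fix n t
    assume nt: "(n, t) \<in> N" "t \<le> s"
    have t: "t > 0"
      using N_pos[OF nt(1)] .
    have st: "p ^ s = p ^ (s - t) * p ^ t" "\<pi> ^ (s + 1) = \<pi> ^ (s - t + 1) * \<pi> ^ t"
      using nt(2) by (simp_all flip: power_add)
    have "(\<Sum>j\<in>digit_box (p ^ (s - t)). f (j + p ^ (s - t) *s n))
        = block_sum r a (K + int_vec (p ^ s *s m)) (s - t) (n + p ^ t *s m)"
      unfolding block_sum_def f_def
      by (intro sum.cong refl) (simp add: st(1) vector_add_ldistrib vector_smult_assoc add.assoc)
    also have "absv \<dots> \<le> \<pi> ^ (s - t + 1) * absv (g (s - t + r + 1) (n + p ^ t *s m))"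
      using t nt(2) by (intro IH) simp
    also have "\<dots> \<le> \<pi> ^ (s - t + 1) * (\<pi> ^ t * absv (g (s - t + r + 1 + t) m))"
      by (intro mult_left_mono cond_b nt pi_nonneg)
    also have "\<dots> = ?c"
      using nt(2) unfolding st(2) by (simp add: mult.assoc)
    finally show "absv (\<Sum>j\<in>digit_box (p ^ (s - t)). f (j + p ^ (s - t) *s n)) \<le> ?c" .
  qed
  have main: "absv (\<Sum>j\<in>Psi p N s. f j - w j) \<le> ?c"
  proof (rule absv_sum_bound[OF c])
    fix j
    assume j: "j \<in> Psi p N s"
    define D where "D = A r (a + p *s j + p ^ (s + 1) *s m) / A r (a + p *s j)
      - A (r + 1) (j + p ^ s *s m) / A (r + 1) j"
    have sh: "K + int_vec (p ^ s *s m) - int_vec (j + p ^ s *s m) = K - int_vec j"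
      by (simp add: int_vec_add)
    have sh': "a + p *s (j + p ^ s *s m) = a + p *s j + p ^ (s + 1) *s m"
      by (simp add: vector_add_ldistrib vector_smult_assoc add.assoc)
    \<comment> \<open>The shifts by \<open>p ^ s *s m\<close> cancel in \<open>K - j\<close>, so the
      first products of \<open>f j\<close> and \<open>w j\<close> agree. The second ones leave
      \<open>D\<close> times \<open>A r (a + p *s j)\<close>, which is the denominator in
      (a).\<close>
    have "f j - w j = - (zero_ext (A (r + 1)) (K - int_vec j) * (A r (a + p *s j) * D))"
      unfolding f_def w_def cross_term_def sh sh' D_def
      using A_nz by (simp add: field_simps)
    then have "absv (f j - w j)
        = absv (zero_ext (A (r + 1)) (K - int_vec j)) * (absv (A r (a + p *s j)) * absv D)"
      by (simp only: absv_minus absv_mult)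
    also have "\<dots> \<le> 1 * (absv (A r (a + p *s j)) * (\<pi> ^ (s + 1) * (absv (g (r + s + 1) m) / absv (A r (a + p *s j)))))"
      unfolding D_def
      by (intro mult_mono zero_ext_A_le_1 cond_a j a mult_nonneg_nonneg order_refl)
        (simp_all add: absv_nonneg)
    also have "\<dots> = ?c"
      using A_pos[of r "a + p *s j"] by (simp add: add.commute)
    finally show "absv (f j - w j) \<le> ?c" .
  qed
  have "block_sum r a (K + int_vec (p ^ s *s m)) s m
      = (\<Sum>u\<in>digit_box (p ^ s) - Psi p N s. f u) + (\<Sum>j\<in>Psi p N s. f j)"
    unfolding block_sum_def f_def
    by (rule sum.subset_diff[OF Psi_subset finite_digit_box])
  then have "block_sum r a (K + int_vec (p ^ s *s m)) s m - (\<Sum>j\<in>Psi p N s. w j)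
      = (\<Sum>u\<in>digit_box (p ^ s) - Psi p N s. f u) + (\<Sum>j\<in>Psi p N s. f j - w j)"
    by (simp add: sum_subtractf)
  with compl main show ?thesis
    unfolding w_def by (simp add: absv_add_bound)
qed

lemma block_sum_expansion:
  assumes a: "a \<in> digit_box p" and "t \<le> s"
    and IH: "\<And>t K n. t < s \<Longrightarrow> absv (block_sum r a K t n) \<le> \<pi> ^ (t + 1) * absv (g (t + r + 1) n)"
  shows "absv (block_sum r a (K + int_vec (p ^ s *s m)) s m
      - (\<Sum>j\<in>Psi p N (s - t). A (t + r + 1) (j + p ^ (s - t) *s m) / A (t + r + 1) j * block_sum r a K t j))
      \<le> \<pi> ^ (s + 1) * absv (g (s + r + 1) m)" (is "_ \<le> ?c")
  using \<open>t \<le> s\<close>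
proof (induction t)
  case 0
  then show ?case
    using block_sum_expansion_0[OF a IH] by (simp add: block_sum_0)
next
  case (Suc t)
  \<comment> \<open>Going from \<open>t\<close> to \<open>Suc t\<close> moves the summation from
    \<open>Psi\<close> at level \<open>Suc s'\<close> to level \<open>s'\<close>.\<close>
  define s' where "s' = s - Suc t"
  define B where "B = block_sum r a (K + int_vec (p ^ s *s m)) s m"
  define w where "w j = A (t + r + 1) (j + p ^ Suc s' *s m) / A (t + r + 1) j * block_sum r a K t j" for j
  define w' where "w' u = A (t + r + 2) (u + p ^ s' *s m) / A (t + r + 2) u" for u
  define h where "h x = (if x \<in> Psi p N (Suc s') then w x else 0)" for x
  have c: "?c \<ge> 0"
    by (rule modulus_nonneg)
  have s: "s - t = Suc s'" "s = s' + 1 + t"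
    using Suc.prems by (auto simp: s'_def)
  have IHt: "absv (block_sum r a K t n) \<le> \<pi> ^ (t + 1) * absv (g (t + r + 1) n)" for n
    using Suc.prems by (intro IH) simp
  \<comment> \<open>The denominator \<open>g (t + r + 1) j\<close> cancels against the bound on the
    block sum, and the exponents add up: \<open>(s' + 1) + (t + 1) = s + 1\<close>.\<close>
  have bound: "absv (x * block_sum r a K t j) \<le> ?c"
    if "absv x \<le> \<pi> ^ (s' + 1) * (absv (g (s + r + 1) m) / absv (g (t + r + 1) j))" for x j
  proof -
    have "absv (x * block_sum r a K t j)
        \<le> (\<pi> ^ (s' + 1) * (absv (g (s + r + 1) m) / absv (g (t + r + 1) j))) * (\<pi> ^ (t + 1) * absv (g (t + r + 1) j))"
      unfolding absv_mult
      by (intro mult_mono that IHt mult_nonneg_nonneg divide_nonneg_nonneg pi_nonneg absv_nonneg)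
    also have "\<dots> = (\<pi> ^ (s' + 1) * \<pi> ^ (t + 1)) * absv (g (s + r + 1) m)"
      using g_pos[of "t + r + 1" j] by (simp add: field_simps)
    also have "\<pi> ^ (s' + 1) * \<pi> ^ (t + 1) = \<pi> ^ (s + 1)"
      unfolding power_add[symmetric] by (simp add: s(2))
    finally show ?thesis .
  qed
  \<comment> \<open>The coefficient at \<open>v + p *s u\<close> is replaced by \<open>w' u\<close>,
    which does not depend on \<open>v\<close>. Inside \<open>Psi\<close> the error is bounded by
    (a1); outside, \<open>h\<close> is 0 and (a2) makes \<open>w' u\<close> itself small
    enough.\<close>
  have cmp: "absv (h (v + p *s u) - w' u * block_sum r a K t (v + p *s u)) \<le> ?c"
    if u: "u \<in> Psi p N s'" and v: "v \<in> digit_box p" for u v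
  proof (cases "v + p *s u \<in> Psi p N (s' + 1)")
    case True
    have "h (v + p *s u) - w' u * block_sum r a K t (v + p *s u)
      = (A (t + r + 1) (v + p *s u + p ^ (s' + 1) *s m) / A (t + r + 1) (v + p *s u)
         - A (t + r + 1 + 1) (u + p ^ s' *s m) / A (t + r + 1 + 1) u) * block_sum r a K t (v + p *s u)"
      using True by (simp add: h_def w_def w'_def algebra_simps)
    moreover have "t + r + 1 + s' + 1 = s + r + 1"
      by (simp add: s(2))
    ultimately show ?thesis
      using bound[of _ "v + p *s u"] cond_a1[OF u v True, of "t + r + 1" m] by (simp only:)
  next
    case False
    have "h (v + p *s u) - w' u * block_sum r a K t (v + p *s u)
      = - (A (t + r + 1 + 1) (u + p ^ s' *s m) / A (t + r + 1 + 1) u * block_sum r a K t (v + p *s u))"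
      using False by (simp add: h_def w'_def)
    moreover have "s' + (t + r + 1) + 1 = s + r + 1"
      by (simp add: s(2))
    ultimately show ?thesis
      using bound[of _ "v + p *s u"] cond_a2[OF u v False, of "t + r + 1" m] by (simp only: absv_minus)
  qed
  have "(\<Sum>j\<in>Psi p N (Suc s'). w j) = (\<Sum>x\<in>digit_box (p * p ^ s'). h x)"
    using Psi_subset[of p N "Suc s'"]
    by (intro sum.mono_neutral_cong_left) (auto simp: finite_digit_box h_def)
  also have "\<dots> = (\<Sum>u\<in>digit_box (p ^ s'). \<Sum>v\<in>digit_box p. h (v + p *s u))"
    by (rule sum_digit_box_mult[OF p_pos])
  also have "\<dots> = (\<Sum>u\<in>Psi p N s'. \<Sum>v\<in>digit_box p. h (v + p *s u))"
  proof (rule sum.mono_neutral_right[OF finite_digit_box Psi_subset], safe)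
    fix u
    assume "u \<notin> Psi p N s'"
    then show "(\<Sum>v\<in>digit_box p. h (v + p *s u)) = 0"
      using Psi_Suc_iff[where N = N, OF p_pos _ N_pos] by (intro sum.neutral) (simp add: h_def)
  qed
  finally have w: "(\<Sum>j\<in>Psi p N (Suc s'). w j) = (\<Sum>u\<in>Psi p N s'. \<Sum>v\<in>digit_box p. h (v + p *s u))" .
  \<comment> \<open>As \<open>w' u\<close> is constant in \<open>v\<close>, the sub-blocks
    reassemble by \<open>block_sum_Suc\<close> into a block of level \<open>Suc t\<close>.\<close>
  have "(\<Sum>j\<in>Psi p N (Suc s'). w j) - (\<Sum>u\<in>Psi p N s'. w' u * block_sum r a K (Suc t) u)
      = (\<Sum>u\<in>Psi p N s'. \<Sum>v\<in>digit_box p. h (v + p *s u) - w' u * block_sum r a K t (v + p *s u))"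
    unfolding w block_sum_Suc by (simp add: sum_subtractf sum_distrib_left)
  then have "absv ((\<Sum>j\<in>Psi p N (Suc s'). w j) - (\<Sum>u\<in>Psi p N s'. w' u * block_sum r a K (Suc t) u)) \<le> ?c"
    using cmp by (simp only:) (intro absv_sum_bound c)
  moreover have "absv (B - (\<Sum>j\<in>Psi p N (Suc s'). w j)) \<le> ?c"
    using Suc.IH Suc.prems unfolding B_def w_def s(1) by simp
  ultimately have "absv (B - (\<Sum>u\<in>Psi p N s'. w' u * block_sum r a K (Suc t) u)) \<le> ?c"
    using absv_add_bound[of "B - (\<Sum>j\<in>Psi p N (Suc s'). w j)" ?c
        "(\<Sum>j\<in>Psi p N (Suc s'). w j) - (\<Sum>u\<in>Psi p N s'. w' u * block_sum r a K (Suc t) u)"]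
    by simp
  then show ?case
    unfolding B_def w'_def s'_def by simp
qed

section \<open>The block at the origin and the congruence\<close>

text \<open>Induction on the coordinate sum of \<open>K\<close>, a negative coordinate giving 0. The
  vanishing total expresses the block at 0 by those at \<open>m \<noteq> 0\<close>, and
  \<open>shift\<close> reduces each of these to the block at 0 for \<open>K - p ^ s m\<close>, whose
  coordinate sum is smaller or which has a negative coordinate.\<close>

lemma block_sum_origin_bound:
  assumes a: "a \<in> digit_box p"
    and shift: "\<And>K m. absv (block_sum r a (K + int_vec (p ^ s *s m)) s m
      - A (s + r + 1) m / A (s + r + 1) 0 * block_sum r a K s 0) \<le> \<pi> ^ (s + 1) * absv (g (s + r + 1) m)"
  shows "absv (block_sum r a K s 0) \<le> \<pi> ^ (s + 1)"
proof -
  have "absv (block_sum r a (int_vec k) s 0) \<le> \<pi> ^ (s + 1)" for k :: "nat ^ 'd"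
  proof (induction "\<Sum>i\<in>UNIV. k $ i" arbitrary: k rule: less_induct)
    case less
    \<comment> \<open>One more than the coordinate sum: it exceeds every coordinate of
      \<open>k\<close> and keeps 0 in the box even for \<open>k = 0\<close>.\<close>
    define M where "M = Suc (\<Sum>i\<in>UNIV. k $ i)"
    have M: "k $ i < M" for i
      unfolding M_def using member_le_sum[of i UNIV "\<lambda>i. k $ i"] by (simp add: less_Suc_eq_le)
    have other: "absv (block_sum r a (int_vec k) s m) \<le> \<pi> ^ (s + 1)" if "m \<noteq> 0" for m
    proof -
      define K' where "K' = int_vec k - int_vec (p ^ s *s m)"
      have K': "absv (block_sum r a K' s 0) \<le> \<pi> ^ (s + 1)"
      proof (cases "\<exists>i. K' $ i < 0")
        case True
        then show ?thesis
          using block_sum_eq_0[OF a] by (auto simp: absv_0 absv_nonneg)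
      next
        case False
        then obtain k' where k': "K' = int_vec k'"
          using nonneg_int_vecE[of K'] by (metis not_less)
        then have kk: "k $ i = k' $ i + p ^ s * m $ i" for i
          unfolding K'_def vec_eq_iff
          by (simp add: int_vec_nth diff_eq_eq flip: of_nat_power of_nat_mult of_nat_add)
        from that obtain i where "m $ i > 0"
          by (auto simp: vec_eq_iff)
        then have "(\<Sum>i\<in>UNIV. k' $ i) < (\<Sum>i\<in>UNIV. k $ i)"
          using pow_p_pos[of s] by (intro sum_strict_mono_ex1) (auto simp: kk)
        then show ?thesis
          unfolding k' by (rule less)
      qed
      have le1: "absv (A (s + r + 1) m) \<le> 1"
        using A_le_g g_le_1 order_trans by blast
      \<comment> \<open>By \<open>A_0\<close> the denominator has absolute value 1, so the
        coefficient has absolute value at most 1.\<close>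
      have "absv (A (s + r + 1) m / A (s + r + 1) 0 * block_sum r a K' s 0) \<le> 1 * \<pi> ^ (s + 1)"
        unfolding absv_mult absv_divide A_0 using le1 K' by (intro mult_mono) (auto simp: absv_nonneg)
      moreover have "\<pi> ^ (s + 1) * absv (g (s + r + 1) m) \<le> \<pi> ^ (s + 1) * 1"
        by (intro mult_left_mono g_le_1 pi_nonneg)
      then have "absv (block_sum r a (int_vec k) s m
          - A (s + r + 1) m / A (s + r + 1) 0 * block_sum r a K' s 0) \<le> \<pi> ^ (s + 1)"
        using shift[of K' m] unfolding K'_def by simp
      ultimately show ?thesis
        using absv_add_bound[of "block_sum r a (int_vec k) s m
          - A (s + r + 1) m / A (s + r + 1) 0 * block_sum r a K' s 0" "\<pi> ^ (s + 1)"
          "A (s + r + 1) m / A (s + r + 1) 0 * block_sum r a K' s 0"] by simp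
    qed
    have "0 \<in> digit_box M"
      by (simp add: digit_box_iff M_def)
    then have "block_sum r a (int_vec k) s 0 = - (\<Sum>m\<in>digit_box M - {0}. block_sum r a (int_vec k) s m)"
      using sum_block_sum_eq_0[OF a M, of r s] sum.remove[OF finite_digit_box, of 0 M "block_sum r a (int_vec k) s"]
      by (simp add: eq_neg_iff_add_eq_0)
    also have "absv \<dots> \<le> \<pi> ^ (s + 1)"
      unfolding absv_minus by (intro absv_sum_bound pi_nonneg other) simp
    finally show ?case .
  qed
  then show ?thesis
  proof (cases "\<exists>i. K $ i < 0")
    case True
    then show ?thesis
      using block_sum_eq_0[OF a] by (auto simp: absv_0 absv_nonneg)
  qed (metis nonneg_int_vecE not_less)
qed

text \<open>Strong induction on \<open>s\<close>. At \<open>t = s\<close> the expansion runs over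
  \<open>{0}\<close> only and leaves the block at the origin, which contributes the power of
  \<open>\<pi>\<close>; its coefficient contributes the factor \<open>g\<close> through
  \<open>A_le_g\<close>.\<close>

theorem absv_block_sum_bound:
  assumes a: "a \<in> digit_box p"
  shows "absv (block_sum r a K s m) \<le> \<pi> ^ (s + 1) * absv (g (s + r + 1) m)"
proof (induction s arbitrary: K m rule: less_induct)
  case (less s)
  have shift: "absv (block_sum r a (K + int_vec (p ^ s *s m)) s m
      - A (s + r + 1) m / A (s + r + 1) 0 * block_sum r a K s 0) \<le> \<pi> ^ (s + 1) * absv (g (s + r + 1) m)" for K m
    using block_sum_expansion[OF a order_refl, of s r K m] less.IH
    by (simp add: Psi_0[OF N_pos] Suc_0_smult)
  \<comment> \<open>The expansion treats \<open>K' + p ^ s m\<close>, so \<open>K\<close> is shifted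
    back first; \<open>K'\<close> may have negative coordinates.\<close>
  define K' where "K' = K - int_vec (p ^ s *s m)"
  have "absv (A (s + r + 1) m / A (s + r + 1) 0 * block_sum r a K' s 0) \<le> absv (g (s + r + 1) m) * \<pi> ^ (s + 1)"
    unfolding absv_mult absv_divide A_0
    using A_le_g block_sum_origin_bound[OF a shift] by (intro mult_mono) (auto simp: absv_nonneg)
  then show ?case
    using absv_add_bound[OF shift[of K' m], of "A (s + r + 1) m / A (s + r + 1) 0 * block_sum r a K' s 0"]
    by (simp add: K'_def mult.commute)
qed

section \<open>Return to sums over integer vectors\<close>

lemma sum_int_block_eq_block_sum:
  "(\<Sum>j \<in> {int p ^ s *s int_vec m .. int p ^ s *s (int_vec m + 1) - 1}.
      zero_ext (A r) (int_vec a + int p *s (K - j)) * zero_ext (A (r + 1)) j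
      - zero_ext (A (r + 1)) (K - j) * zero_ext (A r) (int_vec a + int p *s j))
    = block_sum r a K s m"
  unfolding of_nat_power[symmetric] int_vec_block block_sum_def cross_term_def
  by (subst sum.reindex[OF inj_int_vec_add], intro sum.cong refl)
    (simp add: zero_ext_int_vec flip: int_vec_smult int_vec_add)

end

theorem theorem4:
  fixes p :: nat
    and absv :: "'a::field_char_0 \<Rightarrow> real"
    and A g :: "nat \<Rightarrow> nat ^ 'd::finite \<Rightarrow> 'a"
    and N :: "((nat ^ 'd) \<times> nat) set"
  assumes "Factorial_Ring.prime p"
    and "completed_algebraic_closure_of_Qp p absv"
    and "\<And>r m. A r m \<noteq> 0"
    and "\<And>r m. g r m \<in> integer_ring absv - {0}"
    and "N \<subseteq> (\<Union>t\<in>{1..}. digit_box (p ^ t) \<times> {t})"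
    and i: "\<And>r. absv (A r 0) = 1"
    and ii: "\<And>r m. A r m \<in> (*) (g r m) ` integer_ring absv"
    and iii_a: "\<And>r s m u v. u \<in> Psi p N s \<Longrightarrow> v \<in> digit_box p \<Longrightarrow>
        A r (v + p *s u + p ^ (s + 1) *s m) / A r (v + p *s u)
          - A (r + 1) (u + p ^ s *s m) / A (r + 1) u
        \<in> (*) (of_nat p ^ (s + 1) * (g (r + s + 1) m / A r (v + p *s u))) ` integer_ring absv"
    and iii_a1: "\<And>r s m u v. u \<in> Psi p N s \<Longrightarrow> v \<in> digit_box p \<Longrightarrow> v + p *s u \<in> Psi p N (s + 1) \<Longrightarrow>
        A r (v + p *s u + p ^ (s + 1) *s m) / A r (v + p *s u)
          - A (r + 1) (u + p ^ s *s m) / A (r + 1) u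
        \<in> (*) (of_nat p ^ (s + 1) * (g (r + s + 1) m / g r (v + p *s u))) ` integer_ring absv"
    and iii_a2: "\<And>r s m u v. u \<in> Psi p N s \<Longrightarrow> v \<in> digit_box p \<Longrightarrow> v + p *s u \<notin> Psi p N (s + 1) \<Longrightarrow>
        A (r + 1) (u + p ^ s *s m) / A (r + 1) u
        \<in> (*) (of_nat p ^ (s + 1) * (g (s + r + 1) m / g r (v + p *s u))) ` integer_ring absv"
    and iii_b: "\<And>r m n t. (n, t) \<in> N \<Longrightarrow>
        g r (n + p ^ t *s m) \<in> (*) (of_nat p ^ t * g (r + t) m) ` integer_ring absv"
  shows "\<forall>a \<in> digit_box p. \<forall>m s r. \<forall>K :: int ^ 'd.
      (\<Sum>j \<in> {int p ^ s *s int_vec m .. int p ^ s *s (int_vec m + 1) - 1}.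
          zero_ext (A r) (int_vec a + int p *s (K - j)) * zero_ext (A (r + 1)) j
          - zero_ext (A (r + 1)) (K - j) * zero_ext (A r) (int_vec a + int p *s j))
      \<in> (*) (of_nat p ^ (s + 1) * g (s + r + 1) m) ` integer_ring absv"
proof -
  interpret completed_algebraic_closure_of_Qp p absv
    by (rule assms(2))
  interpret dwork_congruence absv p A g N
  proof
    show "p > 0"
      using assms(1) by (rule prime_gt_0_nat)
    show "A r m \<noteq> 0" for r m
      by (rule assms(3))
    show "g r m \<noteq> 0" "absv (g r m) \<le> 1" for r m
      using assms(4)[of r m] by (auto simp: integer_ring_def)
    show "t > 0" if "(n, t) \<in> N" for n t
      using assms(5) that by auto
  qed (use i ii iii_a iii_a1 iii_a2 iii_b in
      \<open>simp_all only: mem_mult_integer_ring_iff absv_mult absv_divide absv_power\<close>)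
  show ?thesis
    unfolding sum_int_block_eq_block_sum mem_mult_integer_ring_iff absv_mult absv_power
    using absv_block_sum_bound by blast
qed

end
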